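(* Let $G$ be an edge-maximal $K_5$-minor-free graph, let $\sigma$ be a signature of $G$ such that $(G,\sigma)$ is balanced, and let a list $L(v)$ of colors with $|L(v)|\geq 3$ be given for every vertex $v\in V(G)$. Then there is a signed tree-coloring $c$ of $(G,\sigma)$ such that $c(v)\in L(v)$ for every $v\in V(G)$. In particular, choosing $L(v)=M_3=\{-1,0,1\}$ for every $v\in V(G)$, such a coloring is a signed tree-$3$-coloring of $(G,\sigma)$, and thus $va(G,\sigma)\leq 3$.
   Context: All graphs are finite, simple and undirected. A signed graph $(G,\sigma)$ is a graph $G$ with a signature $\sigma:E(G)\to\{1,-1\}$; edges with signature $1$ (resp. $-1$) are positive (resp. negative). A signed graph is balanced if every cycle of it contains an even number of negative edges. A graph is edge-maximal $K_5$-minor-free if it has no $K_5$ minor but adding any edge between two non-adjacent vertices creates a $K_5$ minor. Colors are integers, and lists of colors are sets of integers. For a vertex coloring $c:V(G)\to\mathbb{Z}$ and a color $i$, $G^{c}(i,\pm)$ denotes the subgraph of $G$ whose vertices are those colored $i$ or $-i$, and whose edges are the positive edges with both ends colored $i$ or both ends colored $-i$, together with the negative edges with one end colored $i$ and the other colored $-i$. (Equivalently, the edges $uv$ with $c(u)=\sigma(uv)c(v)\in\{i,-i\}$; in particular for $i=0$ every edge joining two vertices colored $0$ is included.) A signed tree-coloring of $(G,\sigma)$ is a vertex coloring $c$ such that $G^{c}(i,\pm)$ is a forest for every color $i=c(u)$, $u\in V(G)$. Let $M_n=\{\pm1,\dots,\pm k\}$ if $n=2k$ and $M_n=\{0,\pm1,\dots,\pm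 k\}$ if $n=2k+1$. A signed tree-$n$-coloring is a signed tree-coloring $c:V(G)\to M_n$. The signed vertex arboricity $va(G,\sigma)$ is the minimum $n$ such that $(G,\sigma)$ admits a signed tree-$n$-coloring. *)

theory Defs
  imports Main
begin

text \<open>A graph is a pair of a vertex set and a set of edges, an edge being a two-element set of
vertices.\<close>

type_synonym 'a graph = "'a set \<times> 'a set set"

abbreviation verts :: "'a graph \<Rightarrow> 'a set" where
  "verts G \<equiv> fst G"

abbreviation edges :: "'a graph \<Rightarrow> 'a set set" where
  "edges G \<equiv> snd G"

definition simple_graph :: "'a graph \<Rightarrow> bool" where
  "simple_graph G \<longleftrightarrow> finite (verts G) \<and> (\<forall>e\<in>edges G. e \<subseteq> verts G \<and> card e = 2)"

definition add_edge :: "'a \<Rightarrow> 'a \<Rightarrow> 'a graph \<Rightarrow> 'a graph" where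
  "add_edge u v G = (verts G, insert {u, v} (edges G))"

definition induced :: "'a graph \<Rightarrow> 'a set \<Rightarrow> 'a graph" where
  "induced G S = (S \<inter> verts G, {e \<in> edges G. e \<subseteq> S})"

definition connected_graph :: "'a graph \<Rightarrow> bool" where
  "connected_graph G \<longleftrightarrow> verts G \<noteq> {} \<and>
     (\<forall>u\<in>verts G. \<forall>v\<in>verts G. (u, v) \<in> {(x, y). {x, y} \<in> edges G}\<^sup>*)"

text \<open>A cycle is given by the cyclic sequence of its (distinct) vertices.\<close>

definition cycle_edges :: "'a list \<Rightarrow> 'a set set" where
  "cycle_edges p = {{p ! i, p ! (Suc i mod length p)} | i. i < length p}"

definition is_cycle :: "'a graph \<Rightarrow> 'a list \<Rightarrow> bool" where
  "is_cycle G p \<longleftrightarrow> 3 \<le> length p \<and> distinct p \<and> set p \<subseteq> verts G \<and> cycle_edges p \<subseteq> edges G"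

definition forest :: "'a graph \<Rightarrow> bool" where
  "forest G \<longleftrightarrow> (\<nexists>p. is_cycle G p)"

text \<open>\<open>H\<close> is a minor of \<open>G\<close> if \<open>G\<close> contains a model of \<open>H\<close>: disjoint connected branch sets
\<open>B x\<close>, one for each vertex \<open>x\<close> of \<open>H\<close>, whose contraction yields a supergraph of \<open>H\<close>.\<close>

definition has_minor :: "'a graph \<Rightarrow> 'b graph \<Rightarrow> bool" where
  "has_minor G H \<longleftrightarrow>
     (\<exists>B :: 'b \<Rightarrow> 'a set.
        (\<forall>x\<in>verts H. B x \<subseteq> verts G \<and> connected_graph (induced G (B x))) \<and>
        (\<forall>x\<in>verts H. \<forall>y\<in>verts H. x \<noteq> y \<longrightarrow> B x \<inter> B y = {}) \<and>
        (\<forall>x y. {x, y} \<in> edges H \<longrightarrow> (\<exists>u\<in>B x. \<exists>v\<in>B y. {u, v} \<in> edges G)))"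

definition complete_graph :: "nat \<Rightarrow> nat graph" where
  "complete_graph n = ({..<n}, {e. e \<subseteq> {..<n} \<and> card e = 2})"

definition edge_maximal_K5_minor_free :: "'a graph \<Rightarrow> bool" where
  "edge_maximal_K5_minor_free G \<longleftrightarrow>
     \<not> has_minor G (complete_graph 5) \<and>
     (\<forall>u\<in>verts G. \<forall>v\<in>verts G. u \<noteq> v \<and> {u, v} \<notin> edges G \<longrightarrow>
        has_minor (add_edge u v G) (complete_graph 5))"

definition signature :: "'a graph \<Rightarrow> ('a set \<Rightarrow> int) \<Rightarrow> bool" where
  "signature G \<sigma> \<longleftrightarrow> (\<forall>e\<in>edges G. \<sigma> e \<in> {1, -1})"

definition balanced :: "'a graph \<Rightarrow> ('a set \<Rightarrow> int) \<Rightarrow> bool" where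
  "balanced G \<sigma> \<longleftrightarrow> (\<forall>p. is_cycle G p \<longrightarrow> even (card {e \<in> cycle_edges p. \<sigma> e = -1}))"

text \<open>The graph \<open>G\<^sup>c(i, \<plusminus>)\<close>.\<close>

definition color_subgraph ::
    "'a graph \<Rightarrow> ('a set \<Rightarrow> int) \<Rightarrow> ('a \<Rightarrow> int) \<Rightarrow> int \<Rightarrow> 'a graph" where
  "color_subgraph G \<sigma> c i =
     ({v \<in> verts G. c v = i \<or> c v = - i},
      {{u, v} | u v. {u, v} \<in> edges G \<and>
         (\<sigma> {u, v} = 1 \<and> (c u = i \<and> c v = i \<or> c u = - i \<and> c v = - i) \<or>
          \<sigma> {u, v} = - 1 \<and> c u = i \<and> c v = - i)})"

definition signed_tree_coloring ::
    "'a graph \<Rightarrow> ('a set \<Rightarrow> int) \<Rightarrow> ('a \<Rightarrow> int) \<Rightarrow> bool" where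
  "signed_tree_coloring G \<sigma> c \<longleftrightarrow> (\<forall>i \<in> c ` verts G. forest (color_subgraph G \<sigma> c i))"

definition color_set :: "nat \<Rightarrow> int set" where
  "color_set n =
     (if even n then {i. 1 \<le> \<bar>i\<bar> \<and> \<bar>i\<bar> \<le> int (n div 2)} else {i. \<bar>i\<bar> \<le> int (n div 2)})"

definition signed_tree_n_coloring ::
    "'a graph \<Rightarrow> ('a set \<Rightarrow> int) \<Rightarrow> nat \<Rightarrow> ('a \<Rightarrow> int) \<Rightarrow> bool" where
  "signed_tree_n_coloring G \<sigma> n c \<longleftrightarrow>
     signed_tree_coloring G \<sigma> c \<and> c ` verts G \<subseteq> color_set n"

text \<open>Such an \<open>n\<close> exists for every finite simple graph: colour the vertices injectively with
positive integers.\<close>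

definition signed_vertex_arboricity :: "'a graph \<Rightarrow> ('a set \<Rightarrow> int) \<Rightarrow> nat" where
  "signed_vertex_arboricity G \<sigma> = (LEAST n. \<exists>c. signed_tree_n_coloring G \<sigma> n c)"

end

theory Submission
  imports Defs
begin

text \<open>A graph without a \<open>K\<^sub>5\<close> minor has few edges: Mader's bound (\<open>Mader_K5\<close>) says that \<open>n \<ge> 3\<close>
vertices and at least \<open>3n - 5\<close> edges force a \<open>K\<^sub>5\<close> minor.  Since subgraphs inherit the absence of
the minor, every nonempty induced subgraph has a vertex of degree at most five
(\<open>K5_minor_free_small_degree\<close>), and the vertices can be colored one at a time, each having at
most five neighbours among the vertices colored before.

When \<open>v\<close> is colored, an earlier neighbour \<open>u\<close> can be joined to \<open>v\<close> in a color subgraph only if \<open>v\<close>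
receives the color \<open>\<sigma>(uv) c(u)\<close>.  Five neighbours name five colors, with repetition, so among
three colors in \<open>L(v)\<close> one is named at most once.  With that color \<open>v\<close> has at most one edge in
its color subgraph, lies on no cycle of it, and the color subgraphs remain forests
(\<open>list_coloring_forests\<close>).

Mader's bound follows from a minimal counterexample.  Deleting edges shows that it has exactly
\<open>3n - 5\<close> edges, hence a vertex \<open>v\<close> of degree at most five, which is not isolated, since deleting
an isolated vertex would give a smaller counterexample.  Contracting an edge must
lose at least four edges, so the ends of each edge have at least three common neighbours.  Thus every
neighbour of \<open>v\<close> is adjacent to at least three of the at most five neighbours of \<open>v\<close>, and so
dense a neighbourhood yields a \<open>K\<^sub>5\<close> minor directly (\<open>K5_minor_from_neighbourhood\<close>).\<close>

section \<open>Neighbourhoods and the handshake identity\<close>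

definition neighbours :: "'a graph \<Rightarrow> 'a \<Rightarrow> 'a set" where
  "neighbours G v = {u. {u, v} \<in> edges G}"

lemma neighbours_subset:
  assumes "simple_graph G"
  shows "neighbours G v \<subseteq> verts G - {v}"
  using assms by (fastforce simp: neighbours_def simple_graph_def)

lemma finite_neighbours:
  assumes "simple_graph G"
  shows "finite (neighbours G v)"
  using neighbours_subset[OF assms] assms
  by (meson finite_Diff finite_subset simple_graph_def)

lemma finite_edges:
  assumes "simple_graph G"
  shows "finite (edges G)"
proof -
  have "edges G \<subseteq> Pow (verts G)" using assms by (auto simp: simple_graph_def)
  then show ?thesis using assms by (meson finite_Pow_iff finite_subset simple_graph_def)
qed

lemma card_incident_edges:
  assumes "simple_graph G"
  shows "card {e \<in> edges G. v \<in> e} = card (neighbours G v)"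
proof -
  have "{e \<in> edges G. v \<in> e} = (\<lambda>u. {u, v}) ` neighbours G v"
  proof
    show "{e \<in> edges G. v \<in> e} \<subseteq> (\<lambda>u. {u, v}) ` neighbours G v"
    proof
      fix e assume e: "e \<in> {e \<in> edges G. v \<in> e}"
      then have "card e = 2" using assms by (auto simp: simple_graph_def)
      with e obtain u where "e = {u, v}" by (auto simp: card_2_iff)
      with e show "e \<in> (\<lambda>u. {u, v}) ` neighbours G v" by (auto simp: neighbours_def)
    qed
  qed (auto simp: neighbours_def)
  moreover have "inj_on (\<lambda>u. {u, v}) (neighbours G v)"
    by (auto simp: inj_on_def doubleton_eq_iff)
  ultimately show ?thesis by (simp add: card_image)
qed

lemma handshake:
  assumes "simple_graph G"
  shows "(\<Sum>v\<in>verts G. card (neighbours G v)) = 2 * card (edges G)"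
proof -
  have "(\<Sum>v\<in>verts G. card {e \<in> edges G. v \<in> e}) = 2 * card (edges G)"
  proof (rule sum_multicount)
    show "finite (verts G)" using assms by (simp add: simple_graph_def)
    show "finite (edges G)" by (rule finite_edges[OF assms])
    show "\<forall>e\<in>edges G. card {v \<in> verts G. v \<in> e} = 2"
    proof
      fix e assume "e \<in> edges G"
      then have "{v \<in> verts G. v \<in> e} = e" "card e = 2"
        using assms by (auto simp: simple_graph_def)
      then show "card {v \<in> verts G. v \<in> e} = 2" by simp
    qed
  qed
  then show ?thesis by (simp add: card_incident_edges[OF assms])
qed

section \<open>Minors of subgraphs and contractions\<close>

lemma has_minor_mono:
  assumes "has_minor G' H" "verts G' \<subseteq> verts G" "edges G' \<subseteq> edges G"
  shows "has_minor G H"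
proof -
  have conn: "connected_graph (induced G S)"
    if S: "S \<subseteq> verts G'" and c: "connected_graph (induced G' S)" for S
  proof -
    have "verts (induced G S) = verts (induced G' S)"
      using S assms(2) by (auto simp: induced_def)
    moreover have "{(x, y). {x, y} \<in> edges (induced G' S)} \<subseteq> {(x, y). {x, y} \<in> edges (induced G S)}"
      using assms(3) by (auto simp: induced_def)
    ultimately show ?thesis
      using c rtrancl_mono unfolding connected_graph_def by (smt (verit) subsetD)
  qed
  obtain B where B: "\<forall>x\<in>verts H. B x \<subseteq> verts G' \<and> connected_graph (induced G' (B x))"
    "\<forall>x\<in>verts H. \<forall>y\<in>verts H. x \<noteq> y \<longrightarrow> B x \<inter> B y = {}"
    "\<forall>x y. {x, y} \<in> edges H \<longrightarrow> (\<exists>u\<in>B x. \<exists>v\<in>B y. {u, v} \<in> edges G')"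
    using assms(1) unfolding has_minor_def by blast
  show ?thesis unfolding has_minor_def
  proof (intro exI[of _ B] conjI)
    show "\<forall>x\<in>verts H. B x \<subseteq> verts G \<and> connected_graph (induced G (B x))"
      using B(1) assms(2) conn by blast
    show "\<forall>x y. {x, y} \<in> edges H \<longrightarrow> (\<exists>u\<in>B x. \<exists>v\<in>B y. {u, v} \<in> edges G)"
      using B(3) assms(3) by blast
  qed (rule B(2))
qed

text \<open>The vertex \<open>u\<close> stands for the contracted edge \<open>uv\<close>, so that contraction stays within the
type of the vertices.\<close>

definition contract :: "'a \<Rightarrow> 'a \<Rightarrow> 'a graph \<Rightarrow> 'a graph" where
  "contract u v G =
     (verts G - {v},
      {e \<in> edges G. v \<notin> e} \<union> (\<lambda>x. {u, x}) ` (neighbours G v - {u}))"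

lemma simple_graph_contract:
  assumes G: "simple_graph G" and uv: "{u, v} \<in> edges G"
  shows "simple_graph (contract u v G)"
proof -
  have N: "neighbours G v \<subseteq> verts G - {v}" by (rule neighbours_subset[OF G])
  have "u \<in> verts G - {v}" using N uv by (auto simp: neighbours_def)
  then show ?thesis using N G by (auto simp: simple_graph_def contract_def card_2_iff)
qed

text \<open>Undoing a contraction: the branch set that contains \<open>u\<close> also receives \<open>v\<close>.  It stays
connected because an edge \<open>ux\<close> created by the contraction lifts to the path \<open>u v x\<close>.\<close>

lemma has_minor_contract:
  assumes G: "simple_graph G" and uv: "{u, v} \<in> edges G"
    and minor: "has_minor (contract u v G) H"
    and H: "simple_graph H"
  shows "has_minor G H"
proof -
  let ?C = "contract u v G"
  obtain B where B: "\<forall>x\<in>verts H. B x \<subseteq> verts ?C \<and> connected_graph (induced ?C (B x))"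
    "\<forall>x\<in>verts H. \<forall>y\<in>verts H. x \<noteq> y \<longrightarrow> B x \<inter> B y = {}"
    "\<forall>x y. {x, y} \<in> edges H \<longrightarrow> (\<exists>a\<in>B x. \<exists>b\<in>B y. {a, b} \<in> edges ?C)"
    using minor unfolding has_minor_def by blast
  define lift where "lift S = (if u \<in> S then insert v S else S)" for S
  have v_in: "v \<in> verts G" using G uv by (auto simp: simple_graph_def)
  have edge_cases: "{a, b} \<in> edges G \<or> (a = u \<and> {v, b} \<in> edges G) \<or> (b = u \<and> {v, a} \<in> edges G)"
    if "{a, b} \<in> edges ?C" for a b
    using that by (auto simp: contract_def neighbours_def doubleton_eq_iff insert_commute)
  have conn: "connected_graph (induced G (lift S))"
    if S: "S \<subseteq> verts ?C" and c: "connected_graph (induced ?C S)" for S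
  proof -
    let ?R = "{(x, y). {x, y} \<in> edges (induced G (lift S))}"
    have sub: "S \<subseteq> lift S" by (auto simp: lift_def)
    have vu: "(v, u) \<in> ?R" "(u, v) \<in> ?R" if "u \<in> S"
      using that uv by (auto simp: lift_def induced_def insert_commute)
    have step: "(a, b) \<in> ?R\<^sup>*" if ab: "{a, b} \<in> edges (induced ?C S)" for a b
    proof -
      have "a \<in> S" "b \<in> S" "{a, b} \<in> edges ?C" using ab by (auto simp: induced_def)
      with edge_cases[of a b] consider "{a, b} \<in> edges G"
        | "a = u" "{v, b} \<in> edges G" | "b = u" "{v, a} \<in> edges G" by blast
      then show ?thesis
      proof cases
        case 1
        then have "(a, b) \<in> ?R" using \<open>a \<in> S\<close> \<open>b \<in> S\<close> sub by (auto simp: induced_def)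
        then show ?thesis by blast
      next
        case 2
        then have "(v, b) \<in> ?R" using \<open>a \<in> S\<close> \<open>b \<in> S\<close> by (auto simp: induced_def lift_def)
        then show ?thesis using vu(2) 2 \<open>a \<in> S\<close>
          by (metis (no_types, lifting) converse_rtrancl_into_rtrancl r_into_rtrancl)
      next
        case 3
        then have "(a, v) \<in> ?R" using \<open>a \<in> S\<close> \<open>b \<in> S\<close>
          by (auto simp: induced_def lift_def insert_commute)
        then show ?thesis using vu(1) 3 \<open>b \<in> S\<close>
          by (metis (no_types, lifting) converse_rtrancl_into_rtrancl r_into_rtrancl)
      qed
    qed
    have S_conn: "(a, b) \<in> ?R\<^sup>*" if "a \<in> S" "b \<in> S" for a b
    proof -
      have "a \<in> verts (induced ?C S)" "b \<in> verts (induced ?C S)"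
        using that S by (auto simp: induced_def)
      then have "(a, b) \<in> {(x, y). {x, y} \<in> edges (induced ?C S)}\<^sup>*"
        using c unfolding connected_graph_def by blast
      then show ?thesis
      proof induction
        case (step y z)
        then show ?case using \<open>\<And>a b. {a, b} \<in> edges (induced ?C S) \<Longrightarrow> (a, b) \<in> ?R\<^sup>*\<close>
          by (metis (no_types, lifting) case_prodD mem_Collect_eq rtrancl_trans)
      qed simp
    qed
    \<comment> \<open>Only \<open>v\<close> can be new in the lifted set, and it is adjacent to \<open>u\<close>.\<close>
    have hub: "\<exists>s\<in>S. (a, s) \<in> ?R\<^sup>* \<and> (s, a) \<in> ?R\<^sup>*" if a: "a \<in> lift S" for a
    proof (cases "a \<in> S")
      case False
      then have "a = v" "u \<in> S" using a by (auto simp: lift_def split: if_splits)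
      then show ?thesis using vu by blast
    qed blast
    have "(a, b) \<in> ?R\<^sup>*" if ab: "a \<in> lift S" "b \<in> lift S" for a b
    proof -
      obtain s t where "s \<in> S" "t \<in> S" "(a, s) \<in> ?R\<^sup>*" "(t, b) \<in> ?R\<^sup>*"
        using hub[OF ab(1)] hub[OF ab(2)] by blast
      then show ?thesis using S_conn[of s t] by (meson rtrancl_trans)
    qed
    moreover have "verts (induced G (lift S)) \<noteq> {}"
      using c S sub by (auto simp: connected_graph_def induced_def contract_def)
    moreover have "verts (induced G (lift S)) \<subseteq> lift S" by (auto simp: induced_def)
    ultimately show ?thesis unfolding connected_graph_def by blast
  qed
  show ?thesis unfolding has_minor_def
  proof (intro exI[of _ "\<lambda>x. lift (B x)"] conjI)
    show "\<forall>x\<in>verts H. lift (B x) \<subseteq> verts G \<and> connected_graph (induced G (lift (B x)))"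
      using B(1) conn v_in by (auto simp: lift_def contract_def)
    have v_out: "v \<notin> B x" if "x \<in> verts H" for x
      using B(1) that by (auto simp: contract_def)
    show "\<forall>x\<in>verts H. \<forall>y\<in>verts H. x \<noteq> y \<longrightarrow> lift (B x) \<inter> lift (B y) = {}"
    proof (intro ballI impI)
      fix x y assume "x \<in> verts H" "y \<in> verts H" "x \<noteq> y"
      with B(2) v_out have "B x \<inter> B y = {}" "v \<notin> B x" "v \<notin> B y" by blast+
      then show "lift (B x) \<inter> lift (B y) = {}" by (auto simp: lift_def)
    qed
    show "\<forall>x y. {x, y} \<in> edges H \<longrightarrow>
        (\<exists>a\<in>lift (B x). \<exists>b\<in>lift (B y). {a, b} \<in> edges G)"
    proof (intro allI impI)
      fix x y assume xy: "{x, y} \<in> edges H"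
      then obtain a b where ab: "a \<in> B x" "b \<in> B y" "{a, b} \<in> edges ?C" using B(3) by blast
      from edge_cases[OF ab(3)] show "\<exists>a\<in>lift (B x). \<exists>b\<in>lift (B y). {a, b} \<in> edges G"
        using ab by (auto simp: lift_def insert_commute)
    qed
  qed
qed

text \<open>Contracting \<open>uv\<close> destroys \<open>uv\<close> itself and merges the two edges to each common neighbour;
every other edge at \<open>v\<close> survives as an edge at \<open>u\<close>.\<close>

lemma card_edges_contract:
  assumes G: "simple_graph G" and uv: "{u, v} \<in> edges G"
  shows "card (edges G) \<le> card (edges (contract u v G)) + 1 + card (neighbours G u \<inter> neighbours G v)"
proof -
  let ?Nu = "neighbours G u" and ?Nv = "neighbours G v"
  let ?rest = "{e \<in> edges G. v \<notin> e}" and ?new = "(\<lambda>x. {u, x}) ` (?Nv - ?Nu - {u})"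
  note fin = finite_edges[OF G] finite_neighbours[OF G]
  have "edges G = {e \<in> edges G. v \<in> e} \<union> ?rest" by blast
  then have "card (edges G) = card {e \<in> edges G. v \<in> e} + card ?rest"
    using fin by (subst card_Un_disjoint[symmetric]) auto
  then have 1: "card (edges G) = card ?Nv + card ?rest"
    by (simp add: card_incident_edges[OF G])
  have "?Nv \<subseteq> (?Nv - ?Nu - {u}) \<union> (?Nu \<inter> ?Nv) \<union> {u}" by blast
  then have "card ?Nv \<le> card ((?Nv - ?Nu - {u}) \<union> (?Nu \<inter> ?Nv) \<union> {u})"
    using fin by (intro card_mono) auto
  also have "\<dots> \<le> card (?Nv - ?Nu - {u}) + card (?Nu \<inter> ?Nv) + card {u}"
    using card_Un_le by (meson add_le_mono le_refl le_trans)
  finally have 2: "card ?Nv \<le> card (?Nv - ?Nu - {u}) + card (?Nu \<inter> ?Nv) + 1" by simp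
  have "inj_on (\<lambda>x. {u, x}) (?Nv - ?Nu - {u})" by (auto simp: inj_on_def doubleton_eq_iff)
  then have 3: "card ?new = card (?Nv - ?Nu - {u})" by (rule card_image)
  have "?rest \<inter> ?new = {}" by (auto simp: neighbours_def insert_commute)
  then have "card ?rest + card ?new = card (?rest \<union> ?new)"
    using fin by (subst card_Un_disjoint) auto
  also have "\<dots> \<le> card (edges (contract u v G))"
    using fin by (intro card_mono) (auto simp: contract_def)
  finally show ?thesis using 1 2 3 by simp
qed

section \<open>A complete minor from a small dense neighbourhood\<close>

lemma connected_singleton:
  assumes "a \<in> verts G"
  shows "connected_graph (induced G {a})"
  using assms by (auto simp: connected_graph_def induced_def)

lemma connected_doubleton:
  assumes "simple_graph G" "{a, b} \<in> edges G"
  shows "connected_graph (induced G {a, b})"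
proof -
  have "verts (induced G {a, b}) = {a, b}"
    using assms by (auto simp: induced_def simple_graph_def)
  moreover
  have "(a, b) \<in> {(x, y). {x, y} \<in> edges (induced G {a, b})}"
    "(b, a) \<in> {(x, y). {x, y} \<in> edges (induced G {a, b})}"
    using assms by (auto simp: induced_def insert_commute)
  then have "(x, y) \<in> {(x, y). {x, y} \<in> edges (induced G {a, b})}\<^sup>*"
    if "x \<in> {a, b}" "y \<in> {a, b}" for x y using that by blast
  ultimately show ?thesis unfolding connected_graph_def by simp
qed

text \<open>A list of branch sets serves small complete minors well: on a concrete list, \<open>sorted_wrt\<close>
unfolds to one condition for each unordered pair.\<close>

lemma has_complete_minor_if_branch_sets:
  fixes G :: "'a graph"
  assumes sets: "\<And>A. A \<in> set As \<Longrightarrow> A \<subseteq> verts G \<and> connected_graph (induced G A)"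
    and pairs: "sorted_wrt (\<lambda>A B. A \<inter> B = {} \<and> (\<exists>a\<in>A. \<exists>b\<in>B. {a, b} \<in> edges G)) As"
  shows "has_minor G (complete_graph (length As))"
proof -
  have P: "As ! i \<inter> As ! j = {} \<and> (\<exists>a\<in>As ! i. \<exists>b\<in>As ! j. {a, b} \<in> edges G)"
    if ij: "i < length As" "j < length As" "i \<noteq> j" for i j
  proof (cases "i < j")
    case True
    then show ?thesis using sorted_wrt_nth_less[OF pairs True ij(2)] by blast
  next
    case False
    then have "j < i" using ij by simp
    from sorted_wrt_nth_less[OF pairs this ij(1)] show ?thesis
      by (metis Int_commute insert_commute)
  qed
  show ?thesis unfolding has_minor_def
  proof (intro exI[of _ "\<lambda>i. As ! i"] conjI)
    show "\<forall>x\<in>verts (complete_graph (length As)).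
        As ! x \<subseteq> verts G \<and> connected_graph (induced G (As ! x))"
      using sets by (auto simp: complete_graph_def)
    show "\<forall>x\<in>verts (complete_graph (length As)). \<forall>y\<in>verts (complete_graph (length As)).
        x \<noteq> y \<longrightarrow> As ! x \<inter> As ! y = {}"
      using P by (auto simp: complete_graph_def)
    show "\<forall>x y. {x, y} \<in> edges (complete_graph (length As)) \<longrightarrow>
        (\<exists>u\<in>As ! x. \<exists>v\<in>As ! y. {u, v} \<in> edges G)"
    proof (intro allI impI)
      fix x y assume "{x, y} \<in> edges (complete_graph (length As))"
      then have "x < length As" "y < length As" "card {x, y} = 2"
        by (auto simp: complete_graph_def)
      then show "\<exists>u\<in>As ! x. \<exists>v\<in>As ! y. {u, v} \<in> edges G"
        using P[of x y] by (cases "x = y") auto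
    qed
  qed
qed

text \<open>The neighbourhood \<open>N\<close> of \<open>v\<close> has at least four vertices, because a vertex of \<open>N\<close> has three
neighbours in \<open>N\<close> besides itself.  If \<open>N\<close> is complete, four of its vertices and \<open>v\<close> form a
\<open>K\<^sub>5\<close>.  Otherwise \<open>N\<close> has five vertices and its non-adjacent pairs form a matching.  Given such a
pair \<open>a\<close>, \<open>b\<close>, the other three vertices span an edge \<open>yz\<close>; contracting \<open>a\<close> with the last vertex
\<open>x\<close>, which is adjacent to \<open>b\<close>, repairs the missing adjacency.\<close>

lemma K5_minor_from_neighbourhood:
  assumes G: "simple_graph G" and v: "v \<in> verts G"
    and ne: "neighbours G v \<noteq> {}" and le5: "card (neighbours G v) \<le> 5"
    and common: "\<And>u. u \<in> neighbours G v \<Longrightarrow> 3 \<le> card (neighbours G u \<inter> neighbours G v)"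
  shows "has_minor G (complete_graph 5)"
proof -
  let ?N = "neighbours G v" and ?E = "edges G"
  note fin = finite_neighbours[OF G]
  have irrefl: "a \<noteq> b" if "{a, b} \<in> ?E" for a b
    using neighbours_subset[OF G, of b] that by (auto simp: neighbours_def)
  have in_verts: "a \<in> verts G" "b \<in> verts G" if "{a, b} \<in> ?E" for a b
    using G that by (auto simp: simple_graph_def)
  have clique: ?thesis
    if "distinct [p, q, r, s]" "{p, q, r, s} \<subseteq> ?N" "{p, q} \<in> ?E" "{p, r} \<in> ?E" "{p, s} \<in> ?E"
      "{q, r} \<in> ?E" "{q, s} \<in> ?E" "{r, s} \<in> ?E" for p q r s
  proof -
    have "has_minor G (complete_graph (length [{p}, {q}, {r}, {s}, {v}]))"
      using that v irrefl in_verts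
      by (intro has_complete_minor_if_branch_sets)
        (auto simp: neighbours_def intro!: connected_singleton)
    then show ?thesis by (simp add: eval_nat_numeral)
  qed
  \<comment> \<open>The set \<open>S\<close> may contain \<open>u\<close> itself, so this counts \<open>u\<close> together with its non-neighbours.\<close>
  have nonadj: "card ?N > card (S::'a set) + 2" if "u \<in> ?N" "S \<subseteq> ?N" "S \<inter> neighbours G u = {}" for u S
  proof -
    have "card (neighbours G u \<inter> ?N) + card S = card ((neighbours G u \<inter> ?N) \<union> S)"
      using that fin by (subst card_Un_disjoint) (auto intro: finite_subset)
    also have "\<dots> \<le> card ?N" using that fin by (intro card_mono) auto
    finally show ?thesis using common[OF that(1)] by simp
  qed
  have self: "u \<notin> neighbours G u" for u using neighbours_subset[OF G, of u] by blast
  obtain u0 where "u0 \<in> ?N" using ne by blast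
  with nonadj[of u0 "{u0}"] self have ge4: "card ?N \<ge> 4" by auto
  show ?thesis
  proof (cases "\<forall>a\<in>?N. \<forall>b\<in>?N. a \<noteq> b \<longrightarrow> {a, b} \<in> ?E")
    case True
    obtain S where "S \<subseteq> ?N" "card S = 4"
      using obtain_subset_with_card_n[OF ge4] by metis
    then obtain p q r s where S: "S = {p, q, r, s}" "distinct [p, q, r, s]"
      by (auto simp: card_Suc_eq numeral_eq_Suc)
    with \<open>S \<subseteq> ?N\<close> True show ?thesis by (intro clique[of p q r s]) auto
  next
    case False
    then obtain a b where ab: "a \<in> ?N" "b \<in> ?N" "a \<noteq> b" "{a, b} \<notin> ?E" by blast
    have "b \<notin> neighbours G a" using ab by (simp add: neighbours_def insert_commute)
    with nonadj[of a "{a, b}"] self ab le5 have N5: "card ?N = 5" by auto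
    \<comment> \<open>Non-adjacent pairs are disjoint: a second non-neighbour of \<open>u\<close> would need a sixth vertex.\<close>
    have one: "{u, y} \<in> ?E" if "u \<in> ?N" "x \<in> ?N" "y \<in> ?N" "distinct [u, x, y]" "{u, x} \<notin> ?E" for u x y
    proof (rule ccontr)
      assume "{u, y} \<notin> ?E"
      then have "{u, x, y} \<inter> neighbours G u = {}"
        using self that by (auto simp: neighbours_def insert_commute)
      with nonadj[of u "{u, x, y}"] that N5 show False by auto
    qed
    have "card (?N - {a, b}) = 3" using ab N5 fin by (subst card_Diff_subset) auto
    then obtain x' y' z' where rest: "?N - {a, b} = {x', y', z'}" "distinct [x', y', z']"
      by (auto simp: card_Suc_eq numeral_eq_Suc)
    then have inN: "x' \<in> ?N" "y' \<in> ?N" "z' \<in> ?N" "{x', y', z'} \<inter> {a, b} = {}" by blast+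
    obtain x y z where xyz: "{x, y, z} = {x', y', z'}" "distinct [x, y, z]" "{y, z} \<in> ?E"
    proof (cases "{x', y'} \<in> ?E")
      case True
      then show ?thesis using rest(2) that[of z' x' y'] by auto
    next
      case False
      then have "{x', z'} \<in> ?E" using one[of x' y' z'] rest(2) inN by auto
      then show ?thesis using rest(2) that[of y' x' z'] by auto
    qed
    have "?N - {a, b} = {x, y, z}" using rest(1) xyz(1) by simp
    then have "x \<in> ?N - {a, b}" "y \<in> ?N - {a, b}" "z \<in> ?N - {a, b}" by simp_all
    then have mem: "x \<in> ?N" "y \<in> ?N" "z \<in> ?N" "distinct [a, b, x, y, z]"
      using xyz(2) ab(3) by auto
    have a_adj: "{a, w} \<in> ?E" if "w \<in> {x, y, z}" for w
      using one[of a b w] that mem ab by auto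
    have b_adj: "{b, w} \<in> ?E" if "w \<in> {x, y, z}" for w
      using one[of b a w] that mem ab by (auto simp: insert_commute)
    have "has_minor G (complete_graph (length [{a, x}, {b}, {y}, {z}, {v}]))"
    proof (rule has_complete_minor_if_branch_sets)
      fix A assume "A \<in> set [{a, x}, {b}, {y}, {z}, {v}]"
      moreover have "{a, b, x, y, z, v} \<subseteq> verts G"
        using neighbours_subset[OF G, of v] mem ab v by blast
      ultimately show "A \<subseteq> verts G \<and> connected_graph (induced G A)"
        using connected_doubleton[OF G a_adj[of x]] by (auto intro: connected_singleton)
    next
      have "\<forall>w\<in>{a, b, x, y, z}. {w, v} \<in> ?E \<and> w \<noteq> v"
        using mem ab irrefl by (auto simp: neighbours_def)
      then show "sorted_wrt (\<lambda>A B. A \<inter> B = {} \<and> (\<exists>a\<in>A. \<exists>b\<in>B. {a, b} \<in> ?E))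
          [{a, x}, {b}, {y}, {z}, {v}]"
        using mem(4) a_adj[of x] a_adj[of y] a_adj[of z] b_adj[of x] b_adj[of y] b_adj[of z] xyz(3)
        by (auto simp: insert_commute)
    qed
    then show ?thesis by (simp add: eval_nat_numeral)
  qed
qed

section \<open>Mader's bound and degeneracy\<close>

lemma simple_graph_complete: "simple_graph (complete_graph n)"
  by (auto simp: simple_graph_def complete_graph_def)

lemma simple_graph_induced:
  assumes "simple_graph G"
  shows "simple_graph (induced G S)"
  using assms by (auto simp: simple_graph_def induced_def)

text \<open>Induction over the number of vertices and edges.  Every reduction keeps the edge bound:
deletion of an edge when there is one to spare, contraction of an edge whose ends have at most two
common neighbours (one vertex and at most three edges go), and deletion of an isolated vertex.  It
also keeps the vertex bound, because three vertices carry too few edges for the premise and a reduction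
starts from at least four.  Two vertices joined by an edge satisfy the edge bound without a minor.\<close>

theorem Mader_K5:
  assumes "simple_graph G" "card (verts G) \<ge> 3" "card (edges G) + 5 \<ge> 3 * card (verts G)"
  shows "has_minor G (complete_graph 5)"
  using assms
proof (induction "card (verts G) + card (edges G)" arbitrary: G rule: less_induct)
  case less
  note G = less.prems(1)
  have finV: "finite (verts G)" using G by (simp add: simple_graph_def)
  note finE = finite_edges[OF G]
  have hs: "(\<Sum>v\<in>verts G. card (neighbours G v)) = 2 * card (edges G)" by (rule handshake[OF G])
  have "card (verts G) \<noteq> 3"
  proof
    assume V3: "card (verts G) = 3"
    have "card (neighbours G v) \<le> 2" if "v \<in> verts G" for v
    proof -
      have "card (neighbours G v) \<le> card (verts G - {v})"
        using neighbours_subset[OF G] finV by (intro card_mono) auto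
      then show ?thesis using V3 that finV by simp
    qed
    then have "(\<Sum>v\<in>verts G. card (neighbours G v)) \<le> (\<Sum>v\<in>verts G. 2)" by (rule sum_mono)
    then show False using hs V3 less.prems(3) by simp
  qed
  then have V4: "card (verts G) \<ge> 4" using less.prems(2) by simp
  consider (many) "card (edges G) + 5 > 3 * card (verts G)"
    | (contract) u v where "{u, v} \<in> edges G" "card (neighbours G u \<inter> neighbours G v) \<le> 2"
    | (tight) "card (edges G) + 5 = 3 * card (verts G)"
      "\<And>u v. {u, v} \<in> edges G \<Longrightarrow> 3 \<le> card (neighbours G u \<inter> neighbours G v)"
    using less.prems(3) by (metis le_neq_implies_less not_less_eq_eq numeral_2_eq_2 numeral_3_eq_3)
  then show ?case
  proof cases
    case many
    then obtain e where e: "e \<in> edges G" using V4 by fastforce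
    let ?G' = "(verts G, edges G - {e})"
    have card: "card (edges ?G') + 1 = card (edges G)"
      using card_Suc_Diff1[OF finE e] by simp
    have "has_minor ?G' (complete_graph 5)"
    proof (rule less.hyps)
      show "simple_graph ?G'" using G by (auto simp: simple_graph_def)
    qed (use card many V4 in auto)
    then show ?thesis by (rule has_minor_mono) auto
  next
    case contract
    have "v \<in> verts G" using G contract by (auto simp: simple_graph_def)
    then have cardV: "card (verts (contract u v G)) + 1 = card (verts G)"
      using card_Suc_Diff1[OF finV] by (simp add: contract_def)
    have "card (edges (contract u v G)) \<le> card ({e \<in> edges G. v \<notin> e}) + card (neighbours G v - {u})"
      unfolding contract_def snd_conv
      by (rule order_trans[OF card_Un_le]) (simp add: card_image_le finite_neighbours[OF G])
    also have "\<dots> \<le> card ({e \<in> edges G. v \<notin> e}) + card {e \<in> edges G. v \<in> e}"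
      by (simp add: card_incident_edges[OF G] card_mono finite_neighbours[OF G])
    also have "\<dots> = card ({e \<in> edges G. v \<notin> e} \<union> {e \<in> edges G. v \<in> e})"
      using finE by (subst card_Un_disjoint) auto
    also have "\<dots> = card (edges G)" by (rule arg_cong[of _ _ card]) blast
    finally have "card (edges (contract u v G)) \<le> card (edges G)" .
    then have "has_minor (contract u v G) (complete_graph 5)"
      using card_edges_contract[OF G contract(1)] contract(2) cardV V4 less.prems(3)
      by (intro less.hyps simple_graph_contract[OF G contract(1)]) simp_all
    then show ?thesis
      by (rule has_minor_contract[OF G contract(1) _ simple_graph_complete])
  next
    case tight
    have "\<exists>v\<in>verts G. card (neighbours G v) \<le> 5"
    proof (rule ccontr)
      assume "\<not> ?thesis"
      then have "(\<Sum>v\<in>verts G. 6) \<le> (\<Sum>v\<in>verts G. card (neighbours G v))"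
        by (intro sum_mono) auto
      then show False using hs tight(1) by simp
    qed
    then obtain v where v: "v \<in> verts G" "card (neighbours G v) \<le> 5" by blast
    show ?thesis
    proof (cases "neighbours G v = {}")
      case True
      let ?G' = "(verts G - {v}, edges G)"
      have "{e \<in> edges G. v \<in> e} = {}"
        using card_incident_edges[OF G, of v] True finE by simp
      then have simple': "simple_graph ?G'" using G by (auto simp: simple_graph_def)
      have "card (verts ?G') + 1 = card (verts G)" using card_Suc_Diff1[OF finV v(1)] by simp
      then have "has_minor ?G' (complete_graph 5)"
        using V4 less.prems(3) by (intro less.hyps simple') simp_all
      then show ?thesis by (rule has_minor_mono) auto
    next
      case False
      then show ?thesis using v tight(2)
        by (intro K5_minor_from_neighbourhood[OF G]) (auto simp: neighbours_def)
    qed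
  qed
qed

lemma K5_minor_free_small_degree:
  assumes G: "simple_graph G" and K5: "\<not> has_minor G (complete_graph 5)" and ne: "verts G \<noteq> {}"
  obtains v where "v \<in> verts G" "card (neighbours G v) \<le> 5"
proof (rule ccontr)
  note witness = that
  assume "\<not> thesis"
  then have ge6: "6 \<le> card (neighbours G v)" if "v \<in> verts G" for v
    using that witness[of v] by linarith
  have finV: "finite (verts G)" using G by (simp add: simple_graph_def)
  obtain v where "v \<in> verts G" using ne by blast
  have "6 \<le> card (verts G)"
    using ge6[OF \<open>v \<in> verts G\<close>] neighbours_subset[OF G, of v] finV
    by (meson Diff_subset card_mono le_trans subset_trans)
  moreover have "(\<Sum>v\<in>verts G. 6) \<le> (\<Sum>v\<in>verts G. card (neighbours G v))"
    using ge6 by (rule sum_mono)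
  ultimately have "has_minor G (complete_graph 5)"
    using handshake[OF G] by (intro Mader_K5[OF G]) simp_all
  with K5 show False by simp
qed

section \<open>Greedy list coloring\<close>

lemma cycle_two_neighbours:
  assumes p: "is_cycle G p" and v: "v \<in> set p"
  obtains u w where "u \<noteq> w" "{u, v} \<in> edges G" "{w, v} \<in> edges G"
proof -
  let ?n = "length p"
  have n: "3 \<le> ?n" and d: "distinct p" and E: "cycle_edges p \<subseteq> edges G"
    using p by (auto simp: is_cycle_def)
  obtain i where i: "i < ?n" "v = p ! i" using v by (metis in_set_conv_nth)
  define j where "j = (if i = 0 then ?n - 1 else i - 1)"
  define k where "k = (if Suc i = ?n then 0 else Suc i)"
  have jk: "j < ?n" "k < ?n" "j \<noteq> k" using i n by (auto simp: j_def k_def)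
  have "Suc j mod ?n = i" "Suc i mod ?n = k" using i n by (auto simp: j_def k_def)
  then have "{p ! j, p ! i} \<in> cycle_edges p" "{p ! i, p ! k} \<in> cycle_edges p"
    unfolding cycle_edges_def using jk i by blast+
  then have "{p ! j, v} \<in> edges G" "{p ! k, v} \<in> edges G"
    using E i by (auto simp: insert_commute)
  moreover have "p ! j \<noteq> p ! k" using d jk by (simp add: nth_eq_iff_index_eq)
  ultimately show thesis using that by blast
qed

lemma color_subgraph_edge:
  assumes "{u, v} \<in> edges (color_subgraph G \<sigma> c i)"
  shows "{u, v} \<in> edges G \<and> c v = \<sigma> {u, v} * c u"
  using assms by (auto simp: color_subgraph_def doubleton_eq_iff insert_commute)

text \<open>Recoloring \<open>v\<close> affects only cycles through \<open>v\<close>; the others already lie in the graph without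
\<open>v\<close>.\<close>

lemma is_cycle_avoiding:
  assumes p: "is_cycle (color_subgraph G \<sigma> c' i) p" and v: "v \<notin> set p"
    and c: "\<And>u. u \<noteq> v \<Longrightarrow> c' u = c u"
  shows "is_cycle (color_subgraph (induced G (verts G - {v})) \<sigma> c i) p"
proof -
  have n: "3 \<le> length p" "distinct p" and V: "set p \<subseteq> verts (color_subgraph G \<sigma> c' i)"
    and E: "cycle_edges p \<subseteq> edges (color_subgraph G \<sigma> c' i)"
    using p by (auto simp: is_cycle_def)
  have "set p \<subseteq> verts (color_subgraph (induced G (verts G - {v})) \<sigma> c i)"
    using V v c by (force simp: color_subgraph_def induced_def)
  moreover have "e \<in> edges (color_subgraph (induced G (verts G - {v})) \<sigma> c i)"
    if e: "e \<in> cycle_edges p" for e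
  proof -
    have "e \<subseteq> set p"
      using e n(1) by (auto simp: cycle_edges_def intro!: nth_mem mod_less_divisor)
    then have sub: "e \<subseteq> verts G - {v}" using V v by (auto simp: color_subgraph_def)
    obtain x y where xy: "e = {x, y}" "{x, y} \<in> edges G"
      "\<sigma> {x, y} = 1 \<and> (c' x = i \<and> c' y = i \<or> c' x = - i \<and> c' y = - i) \<or>
       \<sigma> {x, y} = - 1 \<and> c' x = i \<and> c' y = - i"
      using E e by (auto simp: color_subgraph_def)
    have "x \<noteq> v" "y \<noteq> v" using sub xy(1) by auto
    with c have "c' x = c x" "c' y = c y" by simp_all
    with xy sub have "e = {x, y} \<and> {x, y} \<in> edges (induced G (verts G - {v})) \<and>
      (\<sigma> {x, y} = 1 \<and> (c x = i \<and> c y = i \<or> c x = - i \<and> c y = - i) \<or>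
       \<sigma> {x, y} = - 1 \<and> c x = i \<and> c y = - i)"
      by (simp add: induced_def)
    then show ?thesis unfolding color_subgraph_def snd_conv by blast
  qed
  ultimately show ?thesis using n by (auto simp: is_cycle_def)
qed

text \<open>If each of three colors were hit twice, \<open>f\<close> would need six arguments.  For a vertex \<open>v\<close> about to
be colored, \<open>N\<close> is its neighbourhood and \<open>f u\<close> is \<open>\<sigma>(uv) c(u)\<close>, the only color of \<open>v\<close> for which a
color subgraph contains the edge \<open>uv\<close>.\<close>

lemma color_with_one_conflict:
  fixes f :: "'a \<Rightarrow> int"
  assumes N: "finite N" "card N \<le> 5" and L: "infinite L \<or> 3 \<le> card L"
  obtains \<alpha> where "\<alpha> \<in> L" "card {u \<in> N. f u = \<alpha>} \<le> 1"
proof (rule ccontr)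
  note witness = that
  assume "\<not> thesis"
  then have ge2: "2 \<le> card {u \<in> N. f u = \<alpha>}" if "\<alpha> \<in> L" for \<alpha>
    using that witness[of \<alpha>] by linarith
  obtain A where A: "A \<subseteq> L" "finite A" "card A = 3"
    using L by (metis infinite_arbitrarily_large obtain_subset_with_card_n)
  have "(\<Sum>\<alpha>\<in>A. 2) \<le> (\<Sum>\<alpha>\<in>A. card {u \<in> N. f u = \<alpha>})"
    using ge2 A(1) by (intro sum_mono) auto
  also have "\<dots> = card (\<Union>\<alpha>\<in>A. {u \<in> N. f u = \<alpha>})"
    using A(2) N(1) by (subst card_UN_disjoint) auto
  also have "\<dots> \<le> card N" using N(1) by (intro card_mono) auto
  finally show False using A N by simp
qed

text \<open>A vertex of degree at most five is removed and colored last.  The forests are claimed for all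
integers \<open>i\<close>, not only for the colors in use: the color subgraph of \<open>i\<close> may consist of vertices
colored \<open>- i\<close>, and removing a vertex may remove the last use of a color.\<close>

theorem list_coloring_forests:
  fixes L :: "'a \<Rightarrow> int set"
  assumes "simple_graph G" "\<not> has_minor G (complete_graph 5)" "signature G \<sigma>"
    and "\<forall>v\<in>verts G. infinite (L v) \<or> card (L v) \<ge> 3"
  shows "\<exists>c. (\<forall>i. forest (color_subgraph G \<sigma> c i)) \<and> (\<forall>v\<in>verts G. c v \<in> L v)"
  using assms
proof (induction "card (verts G)" arbitrary: G)
  case 0
  then have "verts G = {}" by (simp add: simple_graph_def)
  then have "forest (color_subgraph G \<sigma> c i)" for c i
    by (auto simp: forest_def is_cycle_def color_subgraph_def)
  with \<open>verts G = {}\<close> show ?case by simp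
next
  case (Suc n)
  note G = Suc.prems(1)
  have finV: "finite (verts G)" using G by (simp add: simple_graph_def)
  have "verts G \<noteq> {}" using Suc.hyps(2) by auto
  then obtain v where v: "v \<in> verts G" "card (neighbours G v) \<le> 5"
    using K5_minor_free_small_degree[OF G Suc.prems(2)] by blast
  let ?G' = "induced G (verts G - {v})"
  have sub: "verts ?G' = verts G - {v}" "edges ?G' \<subseteq> edges G" by (auto simp: induced_def)
  have "\<exists>c. (\<forall>i. forest (color_subgraph ?G' \<sigma> c i)) \<and> (\<forall>v\<in>verts ?G'. c v \<in> L v)"
  proof (rule Suc.hyps(1))
    show "n = card (verts ?G')" using Suc.hyps(2) v finV sub by simp
    show "simple_graph ?G'" by (rule simple_graph_induced[OF G])
    show "\<not> has_minor ?G' (complete_graph 5)"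
      using Suc.prems(2) has_minor_mono[of ?G' _ G] sub by blast
    show "signature ?G' \<sigma>" using Suc.prems(3) sub by (auto simp: signature_def)
  qed (use Suc.prems(4) sub in auto)
  then obtain c where c: "\<And>i. forest (color_subgraph ?G' \<sigma> c i)" "\<And>u. u \<in> verts ?G' \<Longrightarrow> c u \<in> L u"
    by blast
  obtain \<alpha> where \<alpha>: "\<alpha> \<in> L v" "card {u \<in> neighbours G v. \<sigma> {u, v} * c u = \<alpha>} \<le> 1"
    using color_with_one_conflict[OF finite_neighbours[OF G] v(2), of "L v" "\<lambda>u. \<sigma> {u, v} * c u"]
      Suc.prems(4) v(1) by blast
  let ?c = "c(v := \<alpha>)"
  have "forest (color_subgraph G \<sigma> ?c i)" for i
    unfolding forest_def
  proof
    assume "\<exists>p. is_cycle (color_subgraph G \<sigma> ?c i) p"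
    then obtain p where p: "is_cycle (color_subgraph G \<sigma> ?c i) p" ..
    show False
    proof (cases "v \<in> set p")
      case True
      \<comment> \<open>The two cycle edges at \<open>v\<close> would give two conflicts with the color \<open>\<alpha>\<close>.\<close>
      obtain u w where uw: "u \<noteq> w" "{u, v} \<in> edges (color_subgraph G \<sigma> ?c i)"
        "{w, v} \<in> edges (color_subgraph G \<sigma> ?c i)"
        using cycle_two_neighbours[OF p True] by blast
      have conflict: "x \<in> {u \<in> neighbours G v. \<sigma> {u, v} * c u = \<alpha>}"
        if "{x, v} \<in> edges (color_subgraph G \<sigma> ?c i)" for x
      proof -
        have x: "{x, v} \<in> edges G" "\<alpha> = \<sigma> {x, v} * ?c x"
          using color_subgraph_edge[OF that] by auto
        then have "x \<in> neighbours G v" by (simp add: neighbours_def)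
        moreover from this have "x \<noteq> v" using neighbours_subset[OF G] by blast
        ultimately show ?thesis using x by simp
      qed
      have "card {u, w} \<le> card {u \<in> neighbours G v. \<sigma> {u, v} * c u = \<alpha>}"
        using conflict[OF uw(2)] conflict[OF uw(3)] finite_neighbours[OF G]
        by (intro card_mono) auto
      then show False using uw(1) \<alpha>(2) by simp
    next
      case False
      have "is_cycle (color_subgraph ?G' \<sigma> c i) p"
        by (rule is_cycle_avoiding[OF p False]) simp
      then show False using c(1) unfolding forest_def by blast
    qed
  qed
  moreover have "\<forall>u\<in>verts G. ?c u \<in> L u" using c(2) sub \<alpha>(1) by auto
  ultimately show ?case by blast
qed

theorem theorem11:
  fixes G :: "'a graph" and \<sigma> :: "'a set \<Rightarrow> int"
  assumes "simple_graph G"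
    and "edge_maximal_K5_minor_free G"
    and "signature G \<sigma>"
    and "balanced G \<sigma>"
  shows "(\<forall>L :: 'a \<Rightarrow> int set.
            (\<forall>v\<in>verts G. infinite (L v) \<or> card (L v) \<ge> 3) \<longrightarrow>
            (\<exists>c. signed_tree_coloring G \<sigma> c \<and> (\<forall>v\<in>verts G. c v \<in> L v))) \<and>
         color_set 3 = {-1, 0, 1} \<and>
         (\<exists>c. signed_tree_coloring G \<sigma> c \<and> (\<forall>v\<in>verts G. c v \<in> color_set 3)) \<and>
         (\<forall>c. signed_tree_coloring G \<sigma> c \<and> (\<forall>v\<in>verts G. c v \<in> color_set 3) \<longrightarrow>
            signed_tree_n_coloring G \<sigma> 3 c) \<and>
         signed_vertex_arboricity G \<sigma> \<le> 3"
proof -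
  have K5: "\<not> has_minor G (complete_graph 5)"
    using assms(2) by (simp add: edge_maximal_K5_minor_free_def)
  have list: "\<exists>c. signed_tree_coloring G \<sigma> c \<and> (\<forall>v\<in>verts G. c v \<in> L v)"
    if "\<forall>v\<in>verts G. infinite (L v) \<or> card (L v) \<ge> 3" for L :: "'a \<Rightarrow> int set"
    using list_coloring_forests[OF assms(1) K5 assms(3) that]
    unfolding signed_tree_coloring_def by blast
  have M3: "color_set 3 = {-1, 0, 1}" by (auto simp: color_set_def)
  have exists3: "\<exists>c. signed_tree_coloring G \<sigma> c \<and> (\<forall>v\<in>verts G. c v \<in> color_set 3)"
    using list[of "\<lambda>_. color_set 3"] by (simp add: M3)
  have tree3: "signed_tree_n_coloring G \<sigma> 3 c"
    if "signed_tree_coloring G \<sigma> c" "\<forall>v\<in>verts G. c v \<in> color_set 3" for c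
    using that by (auto simp: signed_tree_n_coloring_def)
  have "signed_vertex_arboricity G \<sigma> \<le> 3"
    unfolding signed_vertex_arboricity_def using exists3 tree3 by (intro Least_le) blast
  with list M3 exists3 tree3 show ?thesis by blast
qed

end
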